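(* Let $G=(V,E)$ be a simple graph, let $F$ be a field of characteristic $0$ or $F=\mathbb{Z}_p$ with $p$ prime, and let $(L,C)$ be an $F$-correspondence assignment on $G$. Let $G^z$ be the multigraph formed by replacing each edge $e\in E(G)$ with $\omega^z(e)$ parallel edges $e_1,\dots,e_{\omega^z(e)}$, and let $(L,C^z)$ be the $F$-correspondence assignment on $G^z$ given by fixed $Z$-signable partial matchings $C^z_{e_1},\dots,C^z_{e_{\omega^z(e)}}$ with $C_e=\bigcup_{i=1}^{\omega^z(e)}C^z_{e_i}$ for each $e\in E(G)$. Suppose there exists an orientation $D$ of $G^z$ such that each edge of $G^z$ is $Z$-signable with respect to $D$ (i.e. each matching $C^z_{e_i}$ is $Z$-signable with respect to the direction given to $e_i$ by $D$), such that $EE(D_{\sigma,\varphi})-EO(D_{\sigma,\varphi})\not\equiv 0_F$, where $D_{\sigma,\varphi}$ is the auxiliary digraph associated with $(L,C^z)$ and $D$ (and a generalized sign function $\varphi_{C^z}=\sigma_{C^z}\varphi_{C^z}^+$ of $(L,C^z)$ with respect to $D$), and such that $|L(v)|\ge d^+_D(v)+1$ for each $v\in V(G)$. Then $G$ is $(L,C)$-colorable.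
   Context: Graphs. Multigraphs and digraphs are finite and loopless; parallel edges are allowed and are regarded as distinct; a graph is simple if it has no parallel edges. Write $e=\{v,w\}$ if $v,w$ are the endpoints of the edge $e$, and $\vec e=(v,w)$ if $\vec e$ is a directed edge from $v$ to $w$. An orientation $D$ of a multigraph $G$ is a digraph on vertex set $V(G)$ obtained by choosing one direction for each edge; $\vec e$ is the directed edge of $D$ corresponding to $e$. $d^+_D(v)$ and $d^-_D(v)$ are the out-degree and in-degree of $v$ in $D$. Eulerian subdigraphs. A digraph $H$ is Eulerian if $d^+_H(v)=d^-_H(v)$ for every vertex $v$ (connectedness is not required). A digraph is even (odd) if it has an even (odd) number of edges. $EE(H)$ and $EO(H)$ denote the numbers of even, respectively odd, spanning Eulerian subdigraphs of $H$ (spanning means having vertex set $V(H)$; the subdigraph with no edges counts). Correspondence assignments. A correspondence assignment $(L,C)$ for a multigraph $G$ consists of lists $L=\{L(v)\}_{v\in V(G)}$ and a function $C$ assigning to every edge $e=\{u,v\}$ a partial matching $C_e$ between $\{u\}\times L(u)$ and $\{v\}\times L(v)$. An $(L,C)$-coloring is a function $f$ with $f(v)\in L(v)$ for all $v$ such that for every edge $e=\{u,v\}$ the pair $\{(u,f(u)),(v,f(v))\}$ is not in $C_e$; $G$ is $(L,C)$-colorable if one exists. For a field $F$, $(L,C)$ is an $F$-correspondence assignment if $L(v)\subseteq F$ for all $v$. $Z$-signable matchings. Let $\langle 1\rangle$ be the additive subgroup of $F$ generated by $1$ (identified with $\mathbb{Z}$ when $F$ has characteristic $0$; equal to $\mathbb{Z}_p$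 when $F=\mathbb{Z}_p$). A partial matching $M$ between $\{v\}\times L(v)$ and $\{w\}\times L(w)$ is $Z$-signable with respect to the orientation $v\to w$ if there exist $\varphi\in\langle 1\rangle\setminus\{0\}$ and $a\in F$ such that $c_1-\varphi c_2=a$ for all $\{(v,c_1),(w,c_2)\}\in M$; it is called $Z$-signable if it is $Z$-signable with respect to at least one of the two orientations $v\to w$, $w\to v$. For $e\in E(G)$, $\omega^z(e)$ is the least $k$ such that $C_e$ is a union of $k$ partial matchings each of which is $Z$-signable. (As all multigraphs are finite, the numbers $\omega^z(e)$ are finite.) Generalized sign function. If each edge of $G^z$ is $Z$-signable with respect to $D$, a generalized sign function of $(L,C^z)$ with respect to $D$ is a function $\varphi_{C^z}:E(G^z)\to\langle 1\rangle\setminus\{0\}$ such that for each $\vec e=(v,w)\in\vec E(D)$ there is $a_{\vec e}\in F$ with $c_1-\varphi_{C^z}(e)c_2=a_{\vec e}$ whenever $\{(v,c_1),(w,c_2)\}\in C^z_e$. One writes $\varphi_{C^z}(e)=\sigma_{C^z}(e)\varphi_{C^z}^+(e)$ with $\sigma_{C^z}(e)\in\{1,-1\}$ and $\varphi_{C^z}^+(e)$ a positive integer: if $F$ has characteristic $0$, $\sigma_{C^z}(e)$ is the sign of the integer $\varphi_{C^z}(e)$ and $\varphi_{C^z}^+(e)=|\varphi_{C^z}(e)|$; if $F=\mathbb{Z}_p$, $\sigma_{C^z}$ may be any function $E(G^z)\to\{1,-1\}$ and $\varphi_{C^z}^+(e)\in\{1,\dots,p-1\}$ is the integer for which $\varphi_{C^z}(e)=\sigma_{C^z}(e)\varphi_{C^z}^+(e)$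 in $\mathbb{Z}_p$. Auxiliary digraph. $D_{\sigma,\varphi}$ is obtained from $D$ by replacing each $\vec e=(v,w)\in\vec E(D)$ as follows: delete $\vec e$, add two new vertices $v_{\vec e},w_{\vec e}$ and the edges $(v,v_{\vec e})$, $(w_{\vec e},w)$; if $\sigma_{C^z}(e)=1$, add $\varphi_{C^z}^+(e)$ parallel edges from $v_{\vec e}$ to $w_{\vec e}$; if $\sigma_{C^z}(e)=-1$, add new vertices $x^1_{\vec e},\dots,x^{\varphi_{C^z}^+(e)}_{\vec e}$ and the edges $(v_{\vec e},x^i_{\vec e})$, $(x^i_{\vec e},w_{\vec e})$ for $1\le i\le\varphi_{C^z}^+(e)$. (New vertices for different edges of $D$ are distinct.) For $n\in\mathbb{Z}$, $n\equiv 0_F$ means $n=0$ if $F$ has characteristic $0$, and $n\equiv 0\pmod p$ if $F=\mathbb{Z}_p$. *)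

theory Defs
  imports
    "Graph_Theory.Digraph_Component"
    "HOL-Computational_Algebra.Group_Closure"
    "HOL-Number_Theory.Cong"
begin

record ('v, 'e) multigraph =
  vertices :: "'v set"
  edges :: "'e set"
  ends :: "'e \<Rightarrow> 'v set"

definition multigraph :: "('v, 'e) multigraph \<Rightarrow> bool" where
  "multigraph G \<longleftrightarrow> finite (vertices G) \<and> finite (edges G) \<and>
     (\<forall>e\<in>edges G. ends G e \<subseteq> vertices G \<and> card (ends G e) = 2)"

definition simple_graph :: "('v, 'e) multigraph \<Rightarrow> bool" where
  "simple_graph G \<longleftrightarrow> multigraph G \<and> inj_on (ends G) (edges G)"

definition replace_parallel :: "('v, 'e) multigraph \<Rightarrow> ('e \<Rightarrow> nat) \<Rightarrow> ('v, 'e \<times> nat) multigraph" where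
  "replace_parallel G k =
     \<lparr>vertices = vertices G, edges = (SIGMA e:edges G. {1..k e}), ends = (\<lambda>(e, i). ends G e)\<rparr>"

definition orientation :: "('v, 'e) multigraph \<Rightarrow> ('v, 'e) pre_digraph \<Rightarrow> bool" where
  "orientation G D \<longleftrightarrow> verts D = vertices G \<and> arcs D = edges G \<and>
     (\<forall>e\<in>edges G. ends G e = {tail D e, head D e})"

definition eulerian :: "('v, 'e) pre_digraph \<Rightarrow> bool" where
  "eulerian H \<longleftrightarrow> (\<forall>v\<in>verts H. out_degree H v = in_degree H v)"

text \<open>A \<open>spanning\<close> subdigraph shares the tail and head functions of its host, so it is
  determined by its arc set and the cardinalities below count arc sets.\<close>

definition EE :: "('v, 'e) pre_digraph \<Rightarrow> nat" where
  "EE D = card {H. spanning H D \<and> eulerian H \<and> even (card (arcs H))}"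

definition EO :: "('v, 'e) pre_digraph \<Rightarrow> nat" where
  "EO D = card {H. spanning H D \<and> eulerian H \<and> odd (card (arcs H))}"

text \<open>A matching between disjoint sets is a set of pairwise disjoint unordered pairs,
  each with one element in either set.\<close>

definition partial_matching :: "'b set set \<Rightarrow> 'b set \<Rightarrow> 'b set \<Rightarrow> bool" where
  "partial_matching M A B \<longleftrightarrow>
     (\<forall>m\<in>M. \<exists>a\<in>A. \<exists>b\<in>B. m = {a, b}) \<and> pairwise disjnt M"

definition correspondence_assignment ::
  "('v, 'e) multigraph \<Rightarrow> ('v \<Rightarrow> 'a set) \<Rightarrow> ('e \<Rightarrow> ('v \<times> 'a) set set) \<Rightarrow> bool" where
  "correspondence_assignment G L C \<longleftrightarrow>
     (\<forall>e\<in>edges G. \<forall>u v. ends G e = {u, v} \<longrightarrow>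
        partial_matching (C e) ({u} \<times> L u) ({v} \<times> L v))"

definition correspondence_coloring ::
  "('v, 'e) multigraph \<Rightarrow> ('v \<Rightarrow> 'a set) \<Rightarrow> ('e \<Rightarrow> ('v \<times> 'a) set set) \<Rightarrow> ('v \<Rightarrow> 'a) \<Rightarrow> bool" where
  "correspondence_coloring G L C f \<longleftrightarrow> (\<forall>v\<in>vertices G. f v \<in> L v) \<and>
     (\<forall>e\<in>edges G. \<forall>u v. ends G e = {u, v} \<longrightarrow> {(u, f u), (v, f v)} \<notin> C e)"

definition colorable ::
  "('v, 'e) multigraph \<Rightarrow> ('v \<Rightarrow> 'a set) \<Rightarrow> ('e \<Rightarrow> ('v \<times> 'a) set set) \<Rightarrow> bool" where
  "colorable G L C \<longleftrightarrow> (\<exists>f. correspondence_coloring G L C f)"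

text \<open>A field \<open>F\<close> is a type \<open>'a\<close> of class \<open>field\<close>, so an \<open>F\<close>-correspondence assignment is a
  correspondence assignment with lists of type \<open>'a set\<close>. The next predicate says that
  the canonical map from the integers induces an isomorphism from \<open>Z/pZ\<close> onto \<open>'a\<close>.\<close>

definition is_Z_mod :: "'a::field itself \<Rightarrow> nat \<Rightarrow> bool" where
  "is_Z_mod _ p \<longleftrightarrow> surj (of_int :: int \<Rightarrow> 'a) \<and>
     (\<forall>m n. (of_int m :: 'a) = of_int n \<longleftrightarrow> [m = n] (mod int p))"

definition vanishes_in :: "'a::field itself \<Rightarrow> int \<Rightarrow> bool" where
  "vanishes_in _ n \<longleftrightarrow> (if CHAR('a) = 0 then n = 0 else [n = 0] (mod int CHAR('a)))"

definition signable_with :: "('v \<times> 'a::field) set set \<Rightarrow> 'v \<Rightarrow> 'v \<Rightarrow> 'a \<Rightarrow> bool" where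
  "signable_with M v w \<phi> \<longleftrightarrow> \<phi> \<in> group_closure {1} - {0} \<and>
     (\<exists>a. \<forall>c\<^sub>1 c\<^sub>2. {(v, c\<^sub>1), (w, c\<^sub>2)} \<in> M \<longrightarrow> c\<^sub>1 - \<phi> * c\<^sub>2 = a)"

definition Z_signable_wrt :: "('v \<times> 'a::field) set set \<Rightarrow> 'v \<Rightarrow> 'v \<Rightarrow> bool" where
  "Z_signable_wrt M v w \<longleftrightarrow> (\<exists>\<phi>. signable_with M v w \<phi>)"

definition Z_signable_matching ::
  "('v, 'e) multigraph \<Rightarrow> ('v \<Rightarrow> 'a::field set) \<Rightarrow> 'e \<Rightarrow> ('v \<times> 'a) set set \<Rightarrow> bool" where
  "Z_signable_matching G L e M \<longleftrightarrow> (\<exists>v w. ends G e = {v, w} \<and>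
     partial_matching M ({v} \<times> L v) ({w} \<times> L w) \<and>
     (Z_signable_wrt M v w \<or> Z_signable_wrt M w v))"

definition omega_Z ::
  "('v, 'e) multigraph \<Rightarrow> ('v \<Rightarrow> 'a::field set) \<Rightarrow> ('e \<Rightarrow> ('v \<times> 'a) set set) \<Rightarrow> 'e \<Rightarrow> nat" where
  "omega_Z G L C e = (LEAST k. \<exists>M :: nat \<Rightarrow> ('v \<times> 'a) set set.
     (\<forall>i\<in>{1..k}. Z_signable_matching G L e (M i)) \<and> C e = (\<Union>i\<in>{1..k}. M i))"

definition generalized_sign_function ::
  "('v, 'e) pre_digraph \<Rightarrow> ('e \<Rightarrow> ('v \<times> 'a::field) set set) \<Rightarrow> ('e \<Rightarrow> 'a) \<Rightarrow> bool" where
  "generalized_sign_function D C \<phi> \<longleftrightarrow>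
     (\<forall>e\<in>arcs D. signable_with (C e) (tail D e) (head D e) (\<phi> e))"

text \<open>In positive characteristic the sign is a free choice.\<close>

definition sign_factorization ::
  "'e set \<Rightarrow> ('e \<Rightarrow> 'a::field) \<Rightarrow> ('e \<Rightarrow> int) \<Rightarrow> ('e \<Rightarrow> nat) \<Rightarrow> bool" where
  "sign_factorization E \<phi> \<sigma> \<psi> \<longleftrightarrow> (\<forall>e\<in>E.
     if CHAR('a) = 0 then \<exists>n::int. \<phi> e = of_int n \<and> \<sigma> e = sgn n \<and> int (\<psi> e) = \<bar>n\<bar>
     else \<sigma> e \<in> {1, -1} \<and> \<psi> e \<in> {1..CHAR('a) - 1} \<and> \<phi> e = of_int (\<sigma> e * int (\<psi> e)))"

text \<open>For an arc \<open>e\<close> from \<open>v\<close> to \<open>w\<close>, the new vertices \<open>v_e\<close>, \<open>w_e\<close> and \<open>x^i_e\<close> of the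
  auxiliary digraph are \<open>Near_Tail e\<close>, \<open>Near_Head e\<close> and \<open>Mid e i\<close>.\<close>

datatype ('v, 'e) aux_vertex = Old 'v | Near_Tail 'e | Near_Head 'e | Mid 'e nat

datatype 'e aux_arc = From_Tail 'e | To_Head 'e | Parallel 'e nat | Into_Mid 'e nat | Out_Of_Mid 'e nat

fun aux_tail :: "('v, 'e) pre_digraph \<Rightarrow> 'e aux_arc \<Rightarrow> ('v, 'e) aux_vertex" where
  "aux_tail D (From_Tail e) = Old (tail D e)"
| "aux_tail D (To_Head e) = Near_Head e"
| "aux_tail D (Parallel e i) = Near_Tail e"
| "aux_tail D (Into_Mid e i) = Near_Tail e"
| "aux_tail D (Out_Of_Mid e i) = Mid e i"

fun aux_head :: "('v, 'e) pre_digraph \<Rightarrow> 'e aux_arc \<Rightarrow> ('v, 'e) aux_vertex" where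
  "aux_head D (From_Tail e) = Near_Tail e"
| "aux_head D (To_Head e) = Old (head D e)"
| "aux_head D (Parallel e i) = Near_Head e"
| "aux_head D (Into_Mid e i) = Mid e i"
| "aux_head D (Out_Of_Mid e i) = Near_Head e"

definition aux_digraph ::
  "('v, 'e) pre_digraph \<Rightarrow> ('e \<Rightarrow> int) \<Rightarrow> ('e \<Rightarrow> nat) \<Rightarrow> (('v, 'e) aux_vertex, 'e aux_arc) pre_digraph" where
  "aux_digraph D \<sigma> \<psi> = \<lparr>
     verts = Old ` verts D \<union> Near_Tail ` arcs D \<union> Near_Head ` arcs D
       \<union> {Mid e i | e i. e \<in> arcs D \<and> \<sigma> e = -1 \<and> i \<in> {1..\<psi> e}},
     arcs = From_Tail ` arcs D \<union> To_Head ` arcs D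
       \<union> {Parallel e i | e i. e \<in> arcs D \<and> \<sigma> e = 1 \<and> i \<in> {1..\<psi> e}}
       \<union> {Into_Mid e i | e i. e \<in> arcs D \<and> \<sigma> e = -1 \<and> i \<in> {1..\<psi> e}}
       \<union> {Out_Of_Mid e i | e i. e \<in> arcs D \<and> \<sigma> e = -1 \<and> i \<in> {1..\<psi> e}},
     tail = aux_tail D, head = aux_head D\<rparr>"

end

theory Submission
  imports Defs "HOL-Computational_Algebra.Polynomial"
begin

text \<open>A colouring is a common nonzero of the affine forms \<open>x\<^sub>v - \<phi> x\<^sub>w - a\<close> attached to the
  arcs \<open>(v, w)\<close>, and is found with the Combinatorial Nullstellensatz. Consider in the product of
  these forms the coefficient of the monomial whose exponents are the out-degrees. Expanding the
  product means choosing for each arc its tail, its head or the constant; a choice yields this monomial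
  iff it never takes the constant and takes the head exactly on an Eulerian arc set \<open>S\<close>. So the
  coefficient is the sum, over all Eulerian \<open>S\<close>, of the products of \<open>-\<phi>\<close> over \<open>S\<close>. The gadgets of the
  auxiliary digraph make the signed count of its spanning Eulerian subdigraphs lying over \<open>S\<close> equal
  to the same product.

  Multivariate polynomials are avoided by applying at each vertex the functional
  \<open>p \<mapsto> (\<Sum>a\<in>A. p a / (\<Prod>b\<in>A - {a}. a - b))\<close>, which reads off the coefficient of degree
  \<open>d = card A - 1\<close> from a polynomial \<open>p\<close> of degree at most \<open>d\<close>. A monomial with a larger exponent at
  some vertex has, by total degree, a smaller one than \<open>d\<close> at another vertex, where the functional vanishes.\<close>

section \<open>Coefficient extraction by Lagrange interpolation\<close>

text \<open>Lagrange interpolation on \<open>A\<close> reproduces the monomial of degree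
  \<open>k\<close>, because \<open>k < card A\<close>. The basis polynomial at \<open>a\<close> is
  \<open>q a\<close> divided by \<open>N a\<close>, with \<open>q a\<close> monic of degree
  \<open>d\<close>, so comparing coefficients of degree \<open>d\<close> gives the sum.\<close>

lemma sum_power_over_diff_prod:
  fixes A :: "'a::field set"
  assumes "finite A" "card A = Suc d" "k \<le> d"
  shows "(\<Sum>a\<in>A. a ^ k / (\<Prod>b\<in>A - {a}. a - b)) = (if k = d then 1 else 0)"
proof -
  define q where "q a = (\<Prod>b\<in>A - {a}. [:-b, 1:])" for a
  define N where "N a = (\<Prod>b\<in>A - {a}. a - b)" for a
  define p where "p = (\<Sum>a\<in>A. smult (a ^ k / N a) (q a))"
  have degq: "degree (q a) = d" if "a \<in> A" for a
    using that assms unfolding q_def by (subst degree_prod_eq_sum_degree) auto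
  have lcq: "coeff (q a) d = 1" if "a \<in> A" for a
    using degq[OF that] lead_coeff_prod[of "\<lambda>b. [:-b, 1:]" "A - {a}"] unfolding q_def by simp
  have N0: "N a \<noteq> 0" if "a \<in> A" for a
    using assms(1) by (auto simp: N_def)
  have pq: "poly (q a) c = (if a = c then N c else 0)" if "a \<in> A" "c \<in> A" for a c
    using that assms(1) by (auto simp: q_def N_def poly_prod)
  have pp: "poly p c = c ^ k" if "c \<in> A" for c
  proof -
    have "poly p c = (\<Sum>a\<in>A. if a = c then c ^ k else 0)"
      unfolding p_def poly_sum using that N0 by (intro sum.cong) (auto simp: pq)
    then show ?thesis using that assms(1) by simp
  qed
  have "p = monom 1 k"
  proof (rule poly_eqI_degree[of A])
    have "degree p \<le> d"
      unfolding p_def using degq assms(1) by (intro degree_sum_le) (auto intro: order_trans[OF degree_smult_le])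
    then show "degree p < card A" using assms by simp
    show "degree (monom (1::'a) k) < card A" using assms by (simp add: degree_monom_eq)
  qed (simp add: pp poly_monom)
  then have "coeff p d = (if k = d then 1 else 0)" by simp
  moreover have "coeff p d = (\<Sum>a\<in>A. a ^ k / N a)"
    unfolding p_def coeff_sum by (intro sum.cong) (auto simp: lcq)
  ultimately show ?thesis by (simp add: N_def)
qed

text \<open>Collects the variables picked in one term of an expanded product into a monomial.
  \<open>None\<close> marks a factor from which the constant was picked, which contributes no
  variable.\<close>

lemma prod_option_eq_prod_power_card:
  fixes x :: "'v \<Rightarrow> 'a::comm_monoid_mult"
  assumes "finite E" "finite V" "\<And>e v. e \<in> E \<Longrightarrow> u e = Some v \<Longrightarrow> v \<in> V"
  shows "(\<Prod>e\<in>E. case u e of None \<Rightarrow> 1 | Some v \<Rightarrow> x v) = (\<Prod>v\<in>V. x v ^ card {e \<in> E. u e = Some v})"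
proof -
  have "(\<Prod>e\<in>E. case u e of None \<Rightarrow> 1 | Some v \<Rightarrow> x v) = (\<Prod>e\<in>E. \<Prod>v\<in>V. if u e = Some v then x v else 1)"
    using assms by (intro prod.cong) (auto split: option.split)
  also have "\<dots> = (\<Prod>v\<in>V. \<Prod>e\<in>E. if u e = Some v then x v else 1)"
    by (rule prod.swap)
  also have "\<dots> = (\<Prod>v\<in>V. x v ^ card {e \<in> E. u e = Some v})"
    using assms(1) by (intro prod.cong) (simp_all flip: prod.inter_filter)
  finally show ?thesis .
qed

section \<open>The coefficient as a sum over balanced arc sets\<close>

text \<open>The Eulerian condition for the spanning subdigraph with arc set \<open>S\<close>, stated
  for bare tail and head maps so that the algebra below can use it without digraph records.\<close>

definition balanced :: "'v set \<Rightarrow> ('e \<Rightarrow> 'v) \<Rightarrow> ('e \<Rightarrow> 'v) \<Rightarrow> 'e set \<Rightarrow> bool" where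
  "balanced V t h S \<longleftrightarrow> (\<forall>v\<in>V. card {e \<in> S. t e = v} = card {e \<in> S. h e = v})"

text \<open>The left side applies the one-vertex functionals at all vertices simultaneously. The
  size of \<open>A v\<close> tunes the functional at \<open>v\<close> to the exponent given by the
  out-degree of \<open>v\<close>.\<close>

lemma lagrange_functional_linear_product:
  fixes \<phi> a :: "'e \<Rightarrow> 'a::field"
  assumes fE: "finite E" and fV: "finite V"
    and t: "\<And>e. e \<in> E \<Longrightarrow> t e \<in> V" and h: "\<And>e. e \<in> E \<Longrightarrow> h e \<in> V"
    and fA: "\<And>v. v \<in> V \<Longrightarrow> finite (A v)"
    and cA: "\<And>v. v \<in> V \<Longrightarrow> card (A v) = Suc (card {e \<in> E. t e = v})"
  shows "(\<Sum>x\<in>Pi\<^sub>E V A. (\<Prod>e\<in>E. x (t e) - \<phi> e * x (h e) - a e) /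
             (\<Prod>v\<in>V. \<Prod>b\<in>A v - {x v}. x v - b))
       = (\<Sum>S | S \<subseteq> E \<and> balanced V t h S. \<Prod>e\<in>S. - \<phi> e)"
proof -
  define d where "d v = card {e \<in> E. t e = v}" for v
  define N where "N v y = (\<Prod>b\<in>A v - {y}. y - b)" for v y
  \<comment> \<open>A choice \<open>g\<close> takes at each arc the constant (\<open>None\<close>),
    the head (\<open>Some True\<close>) or the tail (\<open>Some False\<close>). Then
    \<open>c\<close> is the coefficient picked up, \<open>u\<close> the variable, and
    \<open>m g v\<close> the exponent of \<open>x v\<close> in the resulting term.\<close>
  define c where "c e o' = (case o' of None \<Rightarrow> - a e | Some b \<Rightarrow> if b then - \<phi> e else 1)" for e o'
  define u where "u e o' = map_option (\<lambda>b. if b then h e else t e) o'" for e o'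
  define m where "m g v = card {e \<in> E. u e (g e) = Some v}" for g v
  define P where "P = Pi\<^sub>E E (\<lambda>_. UNIV :: bool option set)"
  define good where "good g \<longleftrightarrow> (\<forall>v\<in>V. m g v = d v)" for g
  have fP: "finite P" unfolding P_def using fE by (intro finite_PiE) auto
  have uV: "v \<in> V" if "e \<in> E" "u e o' = Some v" for e o' v
    using that t h by (auto simp: u_def split: if_splits)
  have expand: "(\<Prod>e\<in>E. x (t e) - \<phi> e * x (h e) - a e)
      = (\<Sum>g\<in>P. (\<Prod>e\<in>E. c e (g e)) * (\<Prod>v\<in>V. x v ^ m g v))" for x
  proof -
    have "(\<Prod>e\<in>E. x (t e) - \<phi> e * x (h e) - a e)
      = (\<Prod>e\<in>E. \<Sum>o'\<in>UNIV. c e o' * (case u e o' of None \<Rightarrow> 1 | Some v \<Rightarrow> x v))"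
      by (intro prod.cong) (auto simp: UNIV_option_conv UNIV_bool c_def u_def)
    also have "\<dots> = (\<Sum>g\<in>P. \<Prod>e\<in>E. c e (g e) * (case u e (g e) of None \<Rightarrow> 1 | Some v \<Rightarrow> x v))"
      unfolding P_def using fE by (subst prod_sum_PiE) auto
    also have "\<dots> = (\<Sum>g\<in>P. (\<Prod>e\<in>E. c e (g e)) * (\<Prod>v\<in>V. x v ^ m g v))"
      unfolding prod.distrib m_def using fE fV uV
      by (intro sum.cong refl arg_cong2[of _ _ _ _ "(*)"] prod_option_eq_prod_power_card) auto
    finally show ?thesis .
  qed
  have sumd: "(\<Sum>v\<in>V. d v) = card E"
    unfolding d_def using fE fV t sum.group[of E V t "\<lambda>_. 1::nat"] by auto
  have summ: "(\<Sum>v\<in>V. m g v) = card {e \<in> E. g e \<noteq> None}" for g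
  proof -
    have "(\<Sum>v\<in>V. m g v) = card (\<Union>v\<in>V. {e \<in> E. u e (g e) = Some v})"
      unfolding m_def using fE fV by (intro card_UN_disjoint[symmetric]) auto
    also have "(\<Union>v\<in>V. {e \<in> E. u e (g e) = Some v}) = {e \<in> E. g e \<noteq> None}"
    proof -
      have "(\<exists>v\<in>V. u e (g e) = Some v) \<longleftrightarrow> g e \<noteq> None" if "e \<in> E" for e
        using that t h by (cases "g e") (auto simp: u_def)
      then show ?thesis by blast
    qed
    finally show ?thesis .
  qed
  have fun_eq: "(\<Prod>v\<in>V. \<Sum>y\<in>A v. y ^ m g v / N v y) = (if good g then 1 else 0)" for g
  \<comment> \<open>The value of the functional is known only for exponents up to
    \<open>d v\<close>, hence the search for a vertex with too small an exponent, whose factor is 0.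
    If there is none, comparing total degrees forces equality everywhere, so an exponent above
    \<open>d v\<close> never has to be evaluated.\<close>
  proof (cases "\<exists>v\<in>V. m g v < d v")
    case True
    then obtain v where v: "v \<in> V" "m g v < d v" by blast
    have "(\<Sum>y\<in>A v. y ^ m g v / N v y) = 0"
      unfolding N_def using v fA cA sum_power_over_diff_prod[of "A v" "d v" "m g v"] by (simp add: d_def)
    then have "(\<Prod>v\<in>V. \<Sum>y\<in>A v. y ^ m g v / N v y) = 0" using v fV by (meson prod_zero)
    moreover have "\<not> good g" using v by (metis good_def less_irrefl)
    ultimately show ?thesis by simp
  next
    case False
    have "good g" unfolding good_def
    proof (rule ccontr)
      assume "\<not> (\<forall>v\<in>V. m g v = d v)"
      then obtain v where v: "v \<in> V" "m g v \<noteq> d v" by blast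
      have le: "d w \<le> m g w" if "w \<in> V" for w
        using False that by (simp add: not_less)
      then have "d v < m g v" using v by (metis le_neq_implies_less)
      then have "(\<Sum>v\<in>V. d v) < (\<Sum>v\<in>V. m g v)"
        using le v(1) fV by (intro sum_strict_mono_ex1) blast+
      then have "card E < card {e \<in> E. g e \<noteq> None}" by (simp add: sumd summ)
      moreover have "card {e \<in> E. g e \<noteq> None} \<le> card E" using fE by (intro card_mono) auto
      ultimately show False by simp
    qed
    moreover have "(\<Sum>y\<in>A v. y ^ m g v / N v y) = 1" if "v \<in> V" for v
      unfolding N_def using that \<open>good g\<close> fA cA sum_power_over_diff_prod[of "A v" "d v" "m g v"]
      by (simp add: d_def good_def)
    ultimately show ?thesis by simp
  qed
  have "(\<Sum>x\<in>Pi\<^sub>E V A. (\<Prod>e\<in>E. x (t e) - \<phi> e * x (h e) - a e) / (\<Prod>v\<in>V. N v (x v)))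
      = (\<Sum>x\<in>Pi\<^sub>E V A. \<Sum>g\<in>P. (\<Prod>e\<in>E. c e (g e)) * (\<Prod>v\<in>V. x v ^ m g v / N v (x v)))"
  proof (rule sum.cong[OF refl])
    fix x
    show "(\<Prod>e\<in>E. x (t e) - \<phi> e * x (h e) - a e) / (\<Prod>v\<in>V. N v (x v))
        = (\<Sum>g\<in>P. (\<Prod>e\<in>E. c e (g e)) * (\<Prod>v\<in>V. x v ^ m g v / N v (x v)))"
      unfolding expand[of x] prod_dividef sum_divide_distrib times_divide_eq_right ..
  qed
  also have "\<dots> = (\<Sum>g\<in>P. (\<Prod>e\<in>E. c e (g e)) * (\<Sum>x\<in>Pi\<^sub>E V A. \<Prod>v\<in>V. x v ^ m g v / N v (x v)))"
    unfolding sum_distrib_left by (rule sum.swap)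
  also have "\<dots> = (\<Sum>g\<in>P. (\<Prod>e\<in>E. c e (g e)) * (\<Prod>v\<in>V. \<Sum>y\<in>A v. y ^ m g v / N v y))"
    using fV fA by (subst prod_sum_PiE) auto
  also have "\<dots> = (\<Sum>g\<in>P. if good g then \<Prod>e\<in>E. c e (g e) else 0)"
    unfolding fun_eq by (intro sum.cong) auto
  also have "\<dots> = (\<Sum>g\<in>{g\<in>P. good g}. \<Prod>e\<in>E. c e (g e))"
    by (rule sum.inter_filter[OF fP, symmetric])
  also have "\<dots> = (\<Sum>S | S \<subseteq> E \<and> balanced V t h S. \<Prod>e\<in>S. - \<phi> e)"
  proof -
    \<comment> \<open>An arc outside \<open>S\<close> contributes its tail both to the monomial and
      to the out-degrees. These contributions cancel, leaving heads against tails within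
      \<open>S\<close>.\<close>
    have good_iff: "good g \<longleftrightarrow> balanced V t h S" if S: "S \<subseteq> E" and g: "\<And>e. e \<in> E \<Longrightarrow> g e = Some (e \<in> S)" for g S
    proof -
      have fS: "finite S" using S fE by (rule finite_subset)
      have split: "card ({e \<in> E - S. t e = v} \<union> {e \<in> S. k e = v})
          = card {e \<in> E - S. t e = v} + card {e \<in> S. k e = v}" for k v
        using fE fS by (intro card_Un_disjoint) auto
      have "{e \<in> E. u e (g e) = Some v} = {e \<in> E - S. t e = v} \<union> {e \<in> S. h e = v}" for v
      proof -
        have "u e (g e) = Some v \<longleftrightarrow> (if e \<in> S then h e = v else t e = v)" if "e \<in> E" for e
          unfolding g[OF that] u_def by simp
        then show ?thesis using S by (auto split: if_splits)
      qed
      then have m: "m g v = card {e \<in> E - S. t e = v} + card {e \<in> S. h e = v}" for v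
        unfolding m_def split[symmetric] by simp
      have "{e \<in> E. t e = v} = {e \<in> E - S. t e = v} \<union> {e \<in> S. t e = v}" for v
        using S by auto
      then have d: "d v = card {e \<in> E - S. t e = v} + card {e \<in> S. t e = v}" for v
        unfolding d_def split[symmetric] by simp
      show ?thesis
        unfolding good_def balanced_def m d add_left_cancel by metis
    qed
    \<comment> \<open>A good monomial has total degree \<open>card E\<close>, so no arc can have
      given its constant.\<close>
    have total: "g e = Some True \<or> g e = Some False" if "good g" "e \<in> E" for g e
    proof -
      have "card {e \<in> E. g e \<noteq> None} = card E"
        using that sumd summ[of g] by (simp add: good_def)
      then have "g e \<noteq> None"
        using that fE card_subset_eq[of E "{e \<in> E. g e \<noteq> None}"] by auto
      then show ?thesis by auto
    qed
    show ?thesis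
    proof (rule sum.reindex_bij_witness[where i = "\<lambda>S. \<lambda>e\<in>E. Some (e \<in> S)"
          and j = "\<lambda>g. {e \<in> E. g e = Some True}"], goal_cases)
      case (1 g)
      show ?case
      proof
        fix e show "(\<lambda>e\<in>E. Some (e \<in> {e \<in> E. g e = Some True})) e = g e"
          using 1 total[of g e] by (auto simp: P_def PiE_iff extensional_def)
      qed
    next
      case (2 g)
      have "g e = Some (e \<in> {e \<in> E. g e = Some True})" if "e \<in> E" for e
        using 2 total[of g e] that by auto
      then have "balanced V t h {e \<in> E. g e = Some True}"
        using 2 good_iff[of "{e \<in> E. g e = Some True}" g] by blast
      then show ?case by blast
    next
      case (3 S)
      then show ?case by auto
    next
      case (4 S)
      have "good (\<lambda>e\<in>E. Some (e \<in> S))"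
        by (rule iffD2[OF good_iff[of S]]) (use 4 in auto)
      then show ?case by (simp add: P_def)
    next
      case (5 g)
      have "(\<Prod>e\<in>E. c e (g e)) = (\<Prod>e\<in>E. if g e = Some True then - \<phi> e else 1)"
      proof (rule prod.cong[OF refl])
        fix e assume "e \<in> E"
        then show "c e (g e) = (if g e = Some True then - \<phi> e else 1)"
          using 5 total[of g e] by (auto simp: c_def)
      qed
      then show ?case using prod.inter_filter[OF fE, of "\<lambda>e. - \<phi> e" "\<lambda>e. g e = Some True"] by simp
    qed
  qed
  finally show ?thesis unfolding N_def .
qed

text \<open>A nonzero weighted sum over the grid has a nonzero term, and at that grid point no
  factor of the product vanishes.\<close>

theorem exists_avoiding_of_balanced_sum:
  fixes \<phi> a :: "'e \<Rightarrow> 'a::field"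
  assumes "finite E" "finite V"
    and "\<And>e. e \<in> E \<Longrightarrow> t e \<in> V" "\<And>e. e \<in> E \<Longrightarrow> h e \<in> V"
    and cA: "\<And>v. v \<in> V \<Longrightarrow> finite (A v) \<Longrightarrow> card {e \<in> E. t e = v} + 1 \<le> card (A v)"
    and nz: "(\<Sum>S | S \<subseteq> E \<and> balanced V t h S. \<Prod>e\<in>S. - \<phi> e) \<noteq> 0"
  shows "\<exists>x. (\<forall>v\<in>V. x v \<in> A v) \<and> (\<forall>e\<in>E. x (t e) - \<phi> e * x (h e) \<noteq> a e)"
proof -
  \<comment> \<open>The functionals require sets of exactly the right size. An infinite list, whose
    \<open>card\<close> is 0, still contains finite subsets of every size.\<close>
  have "\<exists>B. B \<subseteq> A v \<and> finite B \<and> card B = Suc (card {e \<in> E. t e = v})" if "v \<in> V" for v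
  proof (cases "finite (A v)")
    case True
    then show ?thesis using cA[OF that] by (metis Suc_eq_plus1 obtain_subset_with_card_n)
  next
    case False
    then show ?thesis using infinite_arbitrarily_large by blast
  qed
  then obtain B where B: "\<And>v. v \<in> V \<Longrightarrow> B v \<subseteq> A v"
      "\<And>v. v \<in> V \<Longrightarrow> finite (B v)" "\<And>v. v \<in> V \<Longrightarrow> card (B v) = Suc (card {e \<in> E. t e = v})"
    by metis
  have "(\<Sum>x\<in>Pi\<^sub>E V B. (\<Prod>e\<in>E. x (t e) - \<phi> e * x (h e) - a e) /
      (\<Prod>v\<in>V. \<Prod>b\<in>B v - {x v}. x v - b)) \<noteq> 0"
    using nz lagrange_functional_linear_product[of E V t h B \<phi> a] assms(1-4) B(2,3) by simp
  then obtain x where x: "x \<in> Pi\<^sub>E V B" "(\<Prod>e\<in>E. x (t e) - \<phi> e * x (h e) - a e) \<noteq> 0"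
    by (metis (no_types, lifting) div_0 sum.neutral)
  then show ?thesis
    using assms(1) B(1) by (intro exI[of _ x]) (auto simp: PiE_iff)
qed

section \<open>Signed counts of Eulerian subdigraphs\<close>

text \<open>As a sum of signs over arc sets, the difference can be grouped and factored gadget by
  gadget.\<close>

lemma EE_minus_EO:
  fixes D :: "('v, 'e) pre_digraph"
  assumes "wf_digraph D" "finite (arcs D)"
  shows "int (EE D) - int (EO D) = (\<Sum>T | T \<subseteq> arcs D \<and> balanced (verts D) (tail D) (head D) T. (-1) ^ card T)"
proof -
  define \<T> where "\<T> = {T. T \<subseteq> arcs D \<and> balanced (verts D) (tail D) (head D) T}"
  have fin: "finite \<T>" unfolding \<T>_def using assms by simp
  have card_eq: "card {H. spanning H D \<and> eulerian H \<and> Q (card (arcs H))} = card {T \<in> \<T>. Q (card T)}" for Q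
  proof (rule bij_betw_same_card)
    show "bij_betw arcs {H. spanning H D \<and> eulerian H \<and> Q (card (arcs H))} {T \<in> \<T>. Q (card T)}"
      using assms(1)
      by (intro bij_betwI[where g = "\<lambda>T. \<lparr>verts = verts D, arcs = T, tail = tail D, head = head D\<rparr>"])
        (auto simp: \<T>_def spanning_def subgraph_def compatible_def eulerian_def balanced_def
          out_degree_def in_degree_def out_arcs_def in_arcs_def wf_digraph_def)
  qed
  have "(\<Sum>T\<in>\<T>. (-1) ^ card T :: int)
      = (\<Sum>T\<in>{T\<in>\<T>. even (card T)}. (-1) ^ card T) + (\<Sum>T\<in>{T\<in>\<T>. odd (card T)}. (-1) ^ card T)"
    using fin by (subst sum.union_disjoint[symmetric]) (auto intro: sum.cong)
  then show ?thesis
    using card_eq[of even] card_eq[of odd] by (simp add: EE_def EO_def \<T>_def)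
qed

section \<open>Eulerian subdigraphs of the auxiliary digraph\<close>

lemma wf_aux_digraph:
  assumes "wf_digraph D"
  shows "wf_digraph (aux_digraph D \<sigma> \<psi>)"
  using assms unfolding wf_digraph_def by (auto simp: aux_digraph_def)

lemma finite_arcs_aux_digraph:
  assumes "finite (arcs D)"
  shows "finite (arcs (aux_digraph D \<sigma> \<psi>))"
proof -
  have "arcs (aux_digraph D \<sigma> \<psi>) \<subseteq> From_Tail ` arcs D \<union> To_Head ` arcs D
     \<union> (\<Union>e\<in>arcs D. Parallel e ` {1..\<psi> e} \<union> Into_Mid e ` {1..\<psi> e} \<union> Out_Of_Mid e ` {1..\<psi> e})"
    by (auto simp: aux_digraph_def)
  then show ?thesis by (rule finite_subset) (use assms in auto)
qed

lemma card_of_bool: "card {x. x = a \<and> P} = of_bool P" "card {x. P \<and> x = a} = of_bool P"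
  by (cases P; simp)+

lemma aux_tail_eq_iff:
  "aux_tail D a = Old v \<longleftrightarrow> (\<exists>e. a = From_Tail e \<and> tail D e = v)"
  "aux_tail D a = Near_Tail e \<longleftrightarrow> (\<exists>i. a = Parallel e i \<or> a = Into_Mid e i)"
  "aux_tail D a = Near_Head e \<longleftrightarrow> a = To_Head e"
  "aux_tail D a = Mid e i \<longleftrightarrow> a = Out_Of_Mid e i"
  by (cases a; auto)+

lemma aux_head_eq_iff:
  "aux_head D a = Old v \<longleftrightarrow> (\<exists>e. a = To_Head e \<and> head D e = v)"
  "aux_head D a = Near_Tail e \<longleftrightarrow> a = From_Tail e"
  "aux_head D a = Near_Head e \<longleftrightarrow> (\<exists>i. a = Parallel e i \<or> a = Out_Of_Mid e i)"
  "aux_head D a = Mid e i \<longleftrightarrow> a = Into_Mid e i"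
  by (cases a; auto)+

text \<open>Balance is read off at each kind of vertex. The \<open>of_bool\<close> terms arise
  because \<open>From_Tail e\<close> is the only arc into \<open>Near_Tail e\<close> and
  \<open>To_Head e\<close> the only arc out of \<open>Near_Head e\<close>.\<close>

lemma balanced_aux_digraph_iff:
  fixes D :: "('v, 'e) pre_digraph"
  assumes T: "T \<subseteq> arcs (aux_digraph D \<sigma> \<psi>)" and fin: "finite (arcs D)"
  shows "balanced (verts (aux_digraph D \<sigma> \<psi>)) (tail (aux_digraph D \<sigma> \<psi>)) (head (aux_digraph D \<sigma> \<psi>)) T \<longleftrightarrow>
    (\<forall>v\<in>verts D. card {e. From_Tail e \<in> T \<and> tail D e = v} = card {e. To_Head e \<in> T \<and> head D e = v}) \<and>
    (\<forall>e\<in>arcs D.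
       card {i. Parallel e i \<in> T} + card {i. Into_Mid e i \<in> T} = of_bool (From_Tail e \<in> T) \<and>
       card {i. Parallel e i \<in> T} + card {i. Out_Of_Mid e i \<in> T} = of_bool (To_Head e \<in> T)) \<and>
    (\<forall>e i. Into_Mid e i \<in> T \<longleftrightarrow> Out_Of_Mid e i \<in> T)"
    (is "?l \<longleftrightarrow> ?old \<and> ?near \<and> ?mid")
proof -
  have finT: "finite T" using T finite_arcs_aux_digraph[OF fin] by (rule finite_subset)
  have fins: "finite {i. Parallel e i \<in> T}" "finite {i. Into_Mid e i \<in> T}" "finite {i. Out_Of_Mid e i \<in> T}" for e
    using finT by (auto intro!: finite_vimageI[of T, unfolded vimage_def] simp: inj_on_def)
  define dt where "dt u = card {a \<in> T. aux_tail D a = u}" for u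
  define dh where "dh u = card {a \<in> T. aux_head D a = u}" for u
  have old: "dt (Old v) = card {e. From_Tail e \<in> T \<and> tail D e = v}"
            "dh (Old v) = card {e. To_Head e \<in> T \<and> head D e = v}" for v
  proof -
    have "{a \<in> T. aux_tail D a = Old v} = From_Tail ` {e. From_Tail e \<in> T \<and> tail D e = v}"
      by (auto simp: aux_tail_eq_iff)
    then show "dt (Old v) = card {e. From_Tail e \<in> T \<and> tail D e = v}"
      unfolding dt_def by (simp add: card_image inj_on_def)
    have "{a \<in> T. aux_head D a = Old v} = To_Head ` {e. To_Head e \<in> T \<and> head D e = v}"
      by (auto simp: aux_head_eq_iff)
    then show "dh (Old v) = card {e. To_Head e \<in> T \<and> head D e = v}"
      unfolding dh_def by (simp add: card_image inj_on_def)
  qed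
  have card2: "card (f ` I \<union> g ` J) = card I + card J"
    if "finite I" "finite J" "inj f" "inj g" "range f \<inter> range g = {}"
    for f g :: "nat \<Rightarrow> 'e aux_arc" and I J
  proof -
    have "f ` I \<inter> g ` J = {}" using that(5) by blast
    then show ?thesis using that
      by (simp add: card_Un_disjoint card_image inj_on_subset[OF _ subset_UNIV])
  qed
  have near_tail: "dt (Near_Tail e) = card {i. Parallel e i \<in> T} + card {i. Into_Mid e i \<in> T}"
                  "dh (Near_Tail e) = of_bool (From_Tail e \<in> T)" for e
  proof -
    have "{a \<in> T. aux_tail D a = Near_Tail e} = Parallel e ` {i. Parallel e i \<in> T} \<union> Into_Mid e ` {i. Into_Mid e i \<in> T}"
      by (auto simp: aux_tail_eq_iff)
    then show "dt (Near_Tail e) = card {i. Parallel e i \<in> T} + card {i. Into_Mid e i \<in> T}"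
      unfolding dt_def by (simp only:, subst card2) (auto simp: fins inj_def)
    have "{a \<in> T. aux_head D a = Near_Tail e} = {a. a = From_Tail e \<and> From_Tail e \<in> T}"
      by (auto simp: aux_head_eq_iff)
    then show "dh (Near_Tail e) = of_bool (From_Tail e \<in> T)"
      unfolding dh_def by (simp add: card_of_bool)
  qed
  have near_head: "dh (Near_Head e) = card {i. Parallel e i \<in> T} + card {i. Out_Of_Mid e i \<in> T}"
                  "dt (Near_Head e) = of_bool (To_Head e \<in> T)" for e
  proof -
    have "{a \<in> T. aux_head D a = Near_Head e} = Parallel e ` {i. Parallel e i \<in> T} \<union> Out_Of_Mid e ` {i. Out_Of_Mid e i \<in> T}"
      by (auto simp: aux_head_eq_iff)
    then show "dh (Near_Head e) = card {i. Parallel e i \<in> T} + card {i. Out_Of_Mid e i \<in> T}"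
      unfolding dh_def by (simp only:, subst card2) (auto simp: fins inj_def)
    have "{a \<in> T. aux_tail D a = Near_Head e} = {a. a = To_Head e \<and> To_Head e \<in> T}"
      by (auto simp: aux_tail_eq_iff)
    then show "dt (Near_Head e) = of_bool (To_Head e \<in> T)"
      unfolding dt_def by (simp add: card_of_bool)
  qed
  have mid: "dt (Mid e i) = of_bool (Out_Of_Mid e i \<in> T)" "dh (Mid e i) = of_bool (Into_Mid e i \<in> T)" for e i
  proof -
    have "{a \<in> T. aux_tail D a = Mid e i} = {a. a = Out_Of_Mid e i \<and> Out_Of_Mid e i \<in> T}"
      by (auto simp: aux_tail_eq_iff)
    then show "dt (Mid e i) = of_bool (Out_Of_Mid e i \<in> T)"
      unfolding dt_def by (simp add: card_of_bool)
    have "{a \<in> T. aux_head D a = Mid e i} = {a. a = Into_Mid e i \<and> Into_Mid e i \<in> T}"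
      by (auto simp: aux_head_eq_iff)
    then show "dh (Mid e i) = of_bool (Into_Mid e i \<in> T)"
      unfolding dh_def by (simp add: card_of_bool)
  qed
  have "?l \<longleftrightarrow> (\<forall>u\<in>verts (aux_digraph D \<sigma> \<psi>). dt u = dh u)"
    by (simp add: balanced_def dt_def dh_def aux_digraph_def)
  also have "\<dots> \<longleftrightarrow> ?old \<and> ?near \<and> (\<forall>e i. e \<in> arcs D \<and> \<sigma> e = -1 \<and> i \<in> {1..\<psi> e} \<longrightarrow> dt (Mid e i) = dh (Mid e i))"
    by (auto simp: aux_digraph_def ball_Un old near_tail near_head simp del: of_bool_eq_iff)
  also have "(\<forall>e i. e \<in> arcs D \<and> \<sigma> e = -1 \<and> i \<in> {1..\<psi> e} \<longrightarrow> dt (Mid e i) = dh (Mid e i)) \<longleftrightarrow> ?mid"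
    using T unfolding mid of_bool_eq_iff by (fastforce simp: aux_digraph_def)
  finally show ?thesis .
qed

text \<open>An Eulerian subdigraph of the auxiliary digraph meets the gadget of an arc \<open>e\<close> either not at all
  or in exactly one path, of odd length 3 if \<open>\<sigma> e = 1\<close> and of even length 4 if \<open>\<sigma> e = -1\<close>.\<close>

definition gadget_path :: "('e \<Rightarrow> int) \<Rightarrow> 'e \<Rightarrow> nat \<Rightarrow> 'e aux_arc set" where
  "gadget_path \<sigma> e i = {From_Tail e, To_Head e} \<union>
     (if \<sigma> e = 1 then {Parallel e i} else {Into_Mid e i, Out_Of_Mid e i})"

lemma mem_gadget_paths:
  "From_Tail e \<in> (\<Union>e\<in>S. gadget_path \<sigma> e (c e)) \<longleftrightarrow> e \<in> S"
  "To_Head e \<in> (\<Union>e\<in>S. gadget_path \<sigma> e (c e)) \<longleftrightarrow> e \<in> S"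
  "Parallel e i \<in> (\<Union>e\<in>S. gadget_path \<sigma> e (c e)) \<longleftrightarrow> e \<in> S \<and> \<sigma> e = 1 \<and> i = c e"
  "Into_Mid e i \<in> (\<Union>e\<in>S. gadget_path \<sigma> e (c e)) \<longleftrightarrow> e \<in> S \<and> \<sigma> e \<noteq> 1 \<and> i = c e"
  "Out_Of_Mid e i \<in> (\<Union>e\<in>S. gadget_path \<sigma> e (c e)) \<longleftrightarrow> e \<in> S \<and> \<sigma> e \<noteq> 1 \<and> i = c e"
  by (auto simp: gadget_path_def split: if_splits)

lemma aux_arc_set_eqI:
  assumes "\<And>e. From_Tail e \<in> T \<longleftrightarrow> From_Tail e \<in> T'" "\<And>e. To_Head e \<in> T \<longleftrightarrow> To_Head e \<in> T'"
    "\<And>e i. Parallel e i \<in> T \<longleftrightarrow> Parallel e i \<in> T'"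
    "\<And>e i. Into_Mid e i \<in> T \<longleftrightarrow> Into_Mid e i \<in> T'"
    "\<And>e i. Out_Of_Mid e i \<in> T \<longleftrightarrow> Out_Of_Mid e i \<in> T'"
  shows "T = T'"
proof (rule set_eqI)
  fix a show "a \<in> T \<longleftrightarrow> a \<in> T'" by (cases a) (simp_all add: assms)
qed

text \<open>Over a balanced set \<open>S\<close> lie the independent choices of one of the
  \<open>\<psi> e\<close> paths in the gadget of each \<open>e\<close> in \<open>S\<close>. Each
  path contributes the sign \<open>- \<sigma> e\<close>, being odd for \<open>\<sigma> e = 1\<close>
  and even for \<open>\<sigma> e = -1\<close>, so the choices over \<open>S\<close> sum to the
  product on the right.\<close>

lemma EE_minus_EO_aux_digraph:
  assumes wf: "wf_digraph D" and fin: "finite (arcs D)"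
    and \<sigma>: "\<And>e. e \<in> arcs D \<Longrightarrow> \<sigma> e \<in> {1, -1}"
  shows "int (EE (aux_digraph D \<sigma> \<psi>)) - int (EO (aux_digraph D \<sigma> \<psi>))
    = (\<Sum>S | S \<subseteq> arcs D \<and> balanced (verts D) (tail D) (head D) S. \<Prod>e\<in>S. - (\<sigma> e * int (\<psi> e)))"
proof -
  let ?A = "aux_digraph D \<sigma> \<psi>"
  define \<S> where "\<S> = {S. S \<subseteq> arcs D \<and> balanced (verts D) (tail D) (head D) S}"
  \<comment> \<open>A pair \<open>(S, c)\<close> records the gadgets used and the path taken in
    each. Extensionality of \<open>c\<close> outside \<open>S\<close> makes \<open>f\<close>
    injective.\<close>
  define I where "I = Sigma \<S> (\<lambda>S. Pi\<^sub>E S (\<lambda>e. {1..\<psi> e}))"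
  define f where "f = (\<lambda>(S, c). \<Union>e\<in>S. gadget_path \<sigma> e (c e))"
  have finS: "finite S" if "S \<in> \<S>" for S
    using that fin by (auto simp: \<S>_def intro: finite_subset)
  have inj: "inj_on f I"
  proof (rule inj_onI, clarify, rule conjI)
    fix S c S' c' assume *: "(S, c) \<in> I" "(S', c') \<in> I" "f (S, c) = f (S', c')"
    then have eq: "(\<Union>e\<in>S. gadget_path \<sigma> e (c e)) = (\<Union>e\<in>S'. gadget_path \<sigma> e (c' e))"
      by (simp add: f_def)
    show "S = S'"
      by (rule set_eqI) (metis eq mem_gadget_paths(1))
    have "c e = c' e" if "e \<in> S" for e
      by (metis eq mem_gadget_paths(3,4) that)
    then show "c = c'"
      using * \<open>S = S'\<close> by (intro PiE_ext[of c S _ c']) (auto simp: I_def)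
  qed
  have img: "f ` I = {T. T \<subseteq> arcs ?A \<and> balanced (verts ?A) (tail ?A) (head ?A) T}" (is "_ = ?R")
  proof (intro equalityI subsetI)
    fix T assume "T \<in> f ` I"
    then obtain S c where S: "S \<in> \<S>" and c: "c \<in> Pi\<^sub>E S (\<lambda>e. {1..\<psi> e})"
      and T: "T = (\<Union>e\<in>S. gadget_path \<sigma> e (c e))"
      by (auto simp: I_def f_def)
    have sub: "S \<subseteq> arcs D" using S by (simp add: \<S>_def)
    have "T \<subseteq> arcs ?A"
      unfolding T using sub c \<sigma> by (fastforce simp: gadget_path_def aux_digraph_def PiE_iff split: if_splits)
    moreover have "balanced (verts ?A) (tail ?A) (head ?A) T"
      unfolding balanced_aux_digraph_iff[OF \<open>T \<subseteq> arcs ?A\<close> fin]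
      unfolding T mem_gadget_paths
      using S by (auto simp: \<S>_def balanced_def card_of_bool)
    ultimately show "T \<in> ?R" by simp
  next
    fix T assume "T \<in> ?R"
    then have sub: "T \<subseteq> arcs ?A" and b: "balanced (verts ?A) (tail ?A) (head ?A) T" by auto
    note b = b[unfolded balanced_aux_digraph_iff[OF sub fin]]
    define S where "S = {e. From_Tail e \<in> T}"
    have SD: "S \<subseteq> arcs D" using sub by (auto simp: S_def aux_digraph_def)
    have memD: "e \<in> arcs D \<and> \<sigma> e = 1 \<and> i \<in> {1..\<psi> e}" if "Parallel e i \<in> T" for e i
      using sub that by (auto simp: aux_digraph_def)
    have memD': "e \<in> arcs D \<and> \<sigma> e = -1 \<and> i \<in> {1..\<psi> e}" if "Into_Mid e i \<in> T" for e i
      using sub that by (auto simp: aux_digraph_def)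
    have io: "Out_Of_Mid e i \<in> T \<longleftrightarrow> Into_Mid e i \<in> T" for e i using b by simp
    \<comment> \<open>Balance at the middle vertices equates the numbers of arcs into and out of
      them, so the two conditions at \<open>Near_Tail e\<close> and \<open>Near_Head e\<close> have
      the same left side.\<close>
    have th: "To_Head e \<in> T \<longleftrightarrow> e \<in> S" for e
    proof (cases "e \<in> arcs D")
      case True
      then have "of_bool (To_Head e \<in> T) = (of_bool (From_Tail e \<in> T) :: nat)"
        using b by (metis (no_types, lifting) Collect_cong)
      then show ?thesis by (simp add: S_def of_bool_eq_iff)
    qed (use sub in \<open>auto simp: S_def aux_digraph_def\<close>)
    \<comment> \<open>The indices of the paths of gadget \<open>e\<close> that \<open>T\<close>
      uses. Balance allows exactly one if \<open>e\<close> is in \<open>S\<close> and none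
      otherwise, which yields the witness \<open>c\<close>.\<close>
    define J where "J e = (if \<sigma> e = 1 then {i. Parallel e i \<in> T} else {i. Into_Mid e i \<in> T})" for e
    have cardJ: "card (J e) = of_bool (e \<in> S)" if "e \<in> arcs D" for e
    proof -
      have "{i. Parallel e i \<in> T} = {}" if "\<sigma> e \<noteq> 1" using memD that by auto
      moreover have "{i. Into_Mid e i \<in> T} = {}" if "\<sigma> e = 1" using memD' that by force
      ultimately show ?thesis using b that by (auto simp: J_def S_def)
    qed
    have "\<exists>i. J e = {i}" if "e \<in> S" for e
      using cardJ[of e] that SD by (auto simp: card_1_singleton_iff)
    then obtain c0 where c0: "\<And>e. e \<in> S \<Longrightarrow> J e = {c0 e}" by metis
    define c where "c = restrict c0 S"
    have c: "J e = {c e}" if "e \<in> S" for e using c0 that by (simp add: c_def)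
    have Jempty: "J e = {}" if "e \<in> arcs D" "e \<notin> S" for e
    proof -
      \<comment> \<open>Infinite sets also have \<open>card\<close> 0, so emptiness requires
        finiteness first.\<close>
      have "finite (J e)"
        by (rule finite_subset[of _ "{1..\<psi> e}"]) (use memD memD' in \<open>auto simp: J_def split: if_splits\<close>)
      then show ?thesis using cardJ[of e] that by simp
    qed
    have J: "i \<in> J e \<longleftrightarrow> e \<in> S \<and> i = c e" if "e \<in> arcs D" for e i
      using c Jempty that by (cases "e \<in> S") auto
    have "Parallel e i \<in> T \<longleftrightarrow> e \<in> arcs D \<and> \<sigma> e = 1 \<and> i \<in> J e" for e i
      using memD[of e i] by (auto simp: J_def)
    then have par: "Parallel e i \<in> T \<longleftrightarrow> e \<in> S \<and> \<sigma> e = 1 \<and> i = c e" for e i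
      using J SD by blast
    have "Into_Mid e i \<in> T \<longleftrightarrow> e \<in> arcs D \<and> \<sigma> e \<noteq> 1 \<and> i \<in> J e" for e i
      using memD'[of e i] by (auto simp: J_def)
    then have into: "Into_Mid e i \<in> T \<longleftrightarrow> e \<in> S \<and> \<sigma> e \<noteq> 1 \<and> i = c e" for e i
      using J SD by blast
    have "S \<in> \<S>"
      using b SD unfolding th by (simp add: \<S>_def balanced_def S_def)
    moreover have "c e \<in> {1..\<psi> e}" if "e \<in> S" for e
      using memD[of e "c e"] memD'[of e "c e"] par[of e "c e"] into[of e "c e"] that by blast
    then have "c \<in> Pi\<^sub>E S (\<lambda>e. {1..\<psi> e})" by (auto simp: c_def)
    moreover have "T = f (S, c)"
      unfolding f_def prod.case
      by (rule aux_arc_set_eqI; unfold mem_gadget_paths) (simp_all add: io th par into, simp add: S_def)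
    ultimately show "T \<in> f ` I" by (auto simp: I_def)
  qed
  \<comment> \<open>Paths in different gadgets share no arc, so their lengths add and their signs
    multiply.\<close>
  have sign: "(-1) ^ card (f (S, c)) = (\<Prod>e\<in>S. - \<sigma> e)" if "S \<in> \<S>" for S c
  proof -
    have "card (f (S, c)) = (\<Sum>e\<in>S. card (gadget_path \<sigma> e (c e)))"
      unfolding f_def prod.case using finS[OF that]
      by (intro card_UN_disjoint) (auto simp: gadget_path_def)
    then have "(-1) ^ card (f (S, c)) = (\<Prod>e\<in>S. (-1) ^ card (gadget_path \<sigma> e (c e)) :: int)"
      by (simp add: power_sum)
    also have "\<dots> = (\<Prod>e\<in>S. - \<sigma> e)"
      using that \<sigma> by (intro prod.cong) (auto simp: \<S>_def gadget_path_def)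
    finally show ?thesis .
  qed
  have "int (EE ?A) - int (EO ?A) = (\<Sum>T\<in>f ` I. (-1) ^ card T)"
    unfolding img by (rule EE_minus_EO[OF wf_aux_digraph[OF wf] finite_arcs_aux_digraph[OF fin]])
  also have "\<dots> = (\<Sum>(S, c)\<in>I. (-1) ^ card (f (S, c)))"
    by (subst sum.reindex[OF inj]) (simp add: comp_def case_prod_unfold)
  also have "\<dots> = (\<Sum>S\<in>\<S>. \<Sum>c\<in>Pi\<^sub>E S (\<lambda>e. {1..\<psi> e}). (-1) ^ card (f (S, c)))"
    unfolding I_def using fin finS
    by (subst sum.Sigma) (auto simp: \<S>_def intro!: finite_PiE)
  also have "\<dots> = (\<Sum>S\<in>\<S>. \<Sum>c\<in>Pi\<^sub>E S (\<lambda>e. {1..\<psi> e}). \<Prod>e\<in>S. - \<sigma> e)"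
    by (simp add: sign)
  also have "\<dots> = (\<Sum>S\<in>\<S>. \<Prod>e\<in>S. - (\<sigma> e * int (\<psi> e)))"
  proof (rule sum.cong[OF refl])
    fix S assume "S \<in> \<S>"
    then have "(\<Sum>c\<in>Pi\<^sub>E S (\<lambda>e. {1..\<psi> e}). \<Prod>e\<in>S. - \<sigma> e) = (\<Prod>e\<in>S. \<Sum>i\<in>{1..\<psi> e}. - \<sigma> e)"
      by (subst prod_sum_PiE) (auto intro: finS)
    then show "(\<Sum>c\<in>Pi\<^sub>E S (\<lambda>e. {1..\<psi> e}). \<Prod>e\<in>S. - \<sigma> e) = (\<Prod>e\<in>S. - (\<sigma> e * int (\<psi> e)))"
      by (simp add: mult.commute)
  qed
  finally show ?thesis by (simp add: \<S>_def)
qed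

section \<open>From the nonvanishing count to a colouring\<close>

text \<open>The kernel of \<open>of_int\<close> consists of the multiples of the characteristic.
  This carries the integer count into the field.\<close>

lemma not_vanishes_in_iff: "\<not> vanishes_in TYPE('a::field) n \<longleftrightarrow> (of_int n :: 'a) \<noteq> 0"
  unfolding vanishes_in_def of_int_eq_0_iff_char_dvd by (auto simp: cong_0_iff)

text \<open>Gives one form of the factorization for every characteristic. In characteristic 0 the
  assumption \<open>\<phi> e \<noteq> 0\<close> excludes the value 0 of \<open>sgn\<close>.\<close>

lemma sign_factorizationD:
  fixes \<phi> :: "'e \<Rightarrow> 'a::field"
  assumes "sign_factorization E \<phi> \<sigma> \<psi>" "e \<in> E" "\<phi> e \<noteq> 0"
  shows "\<sigma> e \<in> {1, -1}" "\<phi> e = of_int (\<sigma> e * int (\<psi> e))"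
proof -
  have "\<sigma> e \<in> {1, -1} \<and> \<phi> e = of_int (\<sigma> e * int (\<psi> e))"
  proof (cases "CHAR('a) = 0")
    case True
    then obtain n where n: "\<phi> e = of_int n" "\<sigma> e = sgn n" "int (\<psi> e) = \<bar>n\<bar>"
      using assms(1,2) unfolding sign_factorization_def by auto
    moreover have "n \<noteq> 0" using n(1) assms(3) by auto
    ultimately show ?thesis by (simp only: sgn_mult_abs) (simp add: sgn_if)
  next
    case False
    then show ?thesis using assms(1,2) unfolding sign_factorization_def by auto
  qed
  then show "\<sigma> e \<in> {1, -1}" "\<phi> e = of_int (\<sigma> e * int (\<psi> e))" by blast+
qed

text \<open>The guard \<open>finite (L v)\<close> on the list sizes reflects that an infinite list
  meets every lower bound, although its \<open>card\<close> is 0.\<close>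

theorem corollary27:
  fixes G :: "('v, 'e) multigraph"
    and L :: "'v \<Rightarrow> 'a::field set"
    and C :: "'e \<Rightarrow> ('v \<times> 'a) set set"
    and Gz :: "('v, 'e \<times> nat) multigraph"
    and Cz :: "'e \<times> nat \<Rightarrow> ('v \<times> 'a) set set"
  assumes "simple_graph G"
    and "CHAR('a) = 0 \<or> (\<exists>p. prime p \<and> is_Z_mod TYPE('a) p)"
    and "correspondence_assignment G L C"
    and "Gz = replace_parallel G (omega_Z G L C)"
    and "\<And>e. e \<in> edges Gz \<Longrightarrow> Z_signable_matching Gz L e (Cz e)"
    and "\<And>e. e \<in> edges G \<Longrightarrow> C e = (\<Union>i\<in>{1..omega_Z G L C e}. Cz (e, i))"
    and "\<exists>D \<phi> \<sigma> \<psi>.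
      orientation Gz D \<and>
      (\<forall>e\<in>edges Gz. Z_signable_wrt (Cz e) (tail D e) (head D e)) \<and>
      generalized_sign_function D Cz \<phi> \<and>
      sign_factorization (edges Gz) \<phi> \<sigma> \<psi> \<and>
      \<not> vanishes_in TYPE('a)
          (int (EE (aux_digraph D \<sigma> \<psi>)) - int (EO (aux_digraph D \<sigma> \<psi>))) \<and>
      (\<forall>v\<in>vertices G. finite (L v) \<longrightarrow> out_degree D v + 1 \<le> card (L v))"
  shows "colorable G L C"
proof -
  obtain D \<phi> \<sigma> \<psi> where D: "orientation Gz D"
    and gsf: "generalized_sign_function D Cz \<phi>"
    and sf: "sign_factorization (edges Gz) \<phi> \<sigma> \<psi>"
    and nv: "\<not> vanishes_in TYPE('a) (int (EE (aux_digraph D \<sigma> \<psi>)) - int (EO (aux_digraph D \<sigma> \<psi>)))"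
    and lists: "\<And>v. v \<in> vertices G \<Longrightarrow> finite (L v) \<Longrightarrow> out_degree D v + 1 \<le> card (L v)"
    using assms(7) by blast
  have G: "finite (vertices G)" "finite (edges G)" "\<And>e. e \<in> edges G \<Longrightarrow> ends G e \<subseteq> vertices G"
    using assms(1) by (auto simp: simple_graph_def multigraph_def)
  have edges: "edges Gz = (SIGMA e:edges G. {1..omega_Z G L C e})"
    by (simp add: assms(4) replace_parallel_def)
  have verts: "verts D = vertices G" and arcs: "arcs D = edges Gz"
    using D by (auto simp: orientation_def assms(4) replace_parallel_def)
  have ends: "ends G e = {tail D (e, i), head D (e, i)}" if "(e, i) \<in> arcs D" for e i
  proof -
    have "ends Gz (e, i) = {tail D (e, i), head D (e, i)}"
      using D that by (auto simp: orientation_def)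
    then show ?thesis by (simp add: assms(4) replace_parallel_def)
  qed
  have fin: "finite (arcs D)" using G(2) by (simp add: arcs edges)
  have tail: "tail D e \<in> verts D" and head: "head D e \<in> verts D" if "e \<in> arcs D" for e
  proof -
    obtain e' i where e: "e = (e', i)" by (cases e)
    then have "e' \<in> edges G" using that by (simp add: arcs edges)
    then show "tail D e \<in> verts D" "head D e \<in> verts D"
      using G(3)[of e'] ends[of e' i] that e by (auto simp: verts)
  qed
  then have wf: "wf_digraph D" by unfold_locales
  have \<phi>: "\<phi> e \<noteq> 0" if "e \<in> arcs D" for e
    using gsf that by (auto simp: generalized_sign_function_def signable_with_def)
  have \<sigma>: "\<sigma> e \<in> {1, -1}" and \<phi>_eq: "\<phi> e = of_int (\<sigma> e * int (\<psi> e))" if "e \<in> arcs D" for e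
    using sign_factorizationD[OF sf] \<phi> that arcs by auto
  \<comment> \<open>All colour pairs matched by \<open>Cz e\<close> lie on one line with constant
    \<open>a e\<close>. A colouring that misses this line therefore avoids the matching.\<close>
  have "\<exists>a. \<forall>c\<^sub>1 c\<^sub>2. {(tail D e, c\<^sub>1), (head D e, c\<^sub>2)} \<in> Cz e \<longrightarrow> c\<^sub>1 - \<phi> e * c\<^sub>2 = a" if "e \<in> arcs D" for e
    using gsf that by (auto simp: generalized_sign_function_def signable_with_def)
  then obtain a where a: "\<And>e c\<^sub>1 c\<^sub>2. e \<in> arcs D \<Longrightarrow>
      {(tail D e, c\<^sub>1), (head D e, c\<^sub>2)} \<in> Cz e \<Longrightarrow> c\<^sub>1 - \<phi> e * c\<^sub>2 = a e"
    by metis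
  have "(\<Sum>S | S \<subseteq> arcs D \<and> balanced (verts D) (tail D) (head D) S. \<Prod>e\<in>S. - \<phi> e)
      = of_int (\<Sum>S | S \<subseteq> arcs D \<and> balanced (verts D) (tail D) (head D) S. \<Prod>e\<in>S. - (\<sigma> e * int (\<psi> e)))"
    unfolding of_int_sum of_int_prod of_int_minus
    by (intro sum.cong prod.cong refl) (use \<phi>_eq in auto)
  also have "\<dots> \<noteq> 0"
    using nv \<sigma> unfolding not_vanishes_in_iff by (subst (asm) EE_minus_EO_aux_digraph[OF wf fin]) auto
  finally have "\<exists>f. (\<forall>v\<in>verts D. f v \<in> L v) \<and>
      (\<forall>e\<in>arcs D. f (tail D e) - \<phi> e * f (head D e) \<noteq> a e)"
    using fin tail head lists G(1)
    by (intro exists_avoiding_of_balanced_sum) (simp_all add: verts out_degree_def out_arcs_def)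
  then obtain f where f: "\<And>v. v \<in> verts D \<Longrightarrow> f v \<in> L v"
    and avoid: "\<And>e. e \<in> arcs D \<Longrightarrow> f (tail D e) - \<phi> e * f (head D e) \<noteq> a e"
    by blast
  have "{(u, f u), (v, f v)} \<notin> C e" if e: "e \<in> edges G" and uv: "ends G e = {u, v}" for e u v
  proof
    assume "{(u, f u), (v, f v)} \<in> C e"
    then obtain i where i: "i \<in> {1..omega_Z G L C e}" "{(u, f u), (v, f v)} \<in> Cz (e, i)"
      using assms(6)[OF e] by blast
    have arc: "(e, i) \<in> arcs D" using e i(1) by (simp add: arcs edges)
    \<comment> \<open>The pair is written as an image of the endpoint set because \<open>u\<close>
      and \<open>v\<close> may name the ends in either order relative to the arc.\<close>
    have "{(u, f u), (v, f v)} = (\<lambda>w. (w, f w)) ` {u, v}" by simp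
    also have "\<dots> = {(tail D (e, i), f (tail D (e, i))), (head D (e, i), f (head D (e, i)))}"
      using ends[OF arc] uv by simp
    finally show False using i(2) a[OF arc] avoid[OF arc] by metis
  qed
  then have "correspondence_coloring G L C f"
    using f by (simp add: correspondence_coloring_def verts)
  then show ?thesis by (auto simp: colorable_def)
qed

end
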